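(* Let $n\le m$ and let $p$ be a degree-$n$ homogeneous real stable polynomial in variables $y_1,\dots,y_m$ with non-negative coefficients. For any set $S\subseteq[m]$ let $c_S$ denote the coefficient of the monomial $y^S:=\prod_{i\in S}y_i$ in $p$. If $\sum_{S\in\binom{[m]}{n}}c_S>0$, then $$\sum_{S\in\binom{[m]}{n}}c_S\;\ge\;\frac{m!\,(m-n)^{m-n}}{m^m\,(m-n)!}\inf_{\substack{{\bf y}>0:\\ y^S\ge 1\ \forall S\in\binom{[m]}{n}}}p({\bf y})\;\ge\;e^{-n}\inf_{\substack{{\bf y}>0:\\ y^S\ge 1\ \forall S\in\binom{[m]}{n}}}p({\bf y}).$$
   Context: A polynomial $p(z_1,\dots,z_m)$ with complex coefficients is stable if $p(z_1,\dots,z_m)\neq 0$ whenever $\mathrm{Im}(z_i)>0$ for all $i$; it is real stable if it is stable and all its coefficients are real. It is degree-$n$ homogeneous if every monomial has degree exactly $n$. $[m]=\{1,\dots,m\}$, $\binom{[m]}{n}$ is the family of $n$-element subsets of $[m]$, and ${\bf y}>0$ means all coordinates are positive. The convention $0^0=1$ is used when $m=n$. *)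

theory Defs
  imports Complex_Main "HOL-Library.Poly_Mapping"
begin

text \<open>
  Multivariate polynomials are finitely supported maps from monomials to coefficients, a monomial
  being the finitely supported map from variable indices to exponents; addition and multiplication
  are those of \<^theory>\<open>HOL-Library.Poly_Mapping\<close>. The variables are indexed by \<^typ>\<open>nat\<close>;
  membership in \<open>mpolys m\<close> restricts them to the indices \<open>1, \<dots>, m\<close>.
\<close>

type_synonym 'a mpoly = "(nat \<Rightarrow>\<^sub>0 nat) \<Rightarrow>\<^sub>0 'a"

definition mpolys :: "nat \<Rightarrow> 'a::zero mpoly set" where
  "mpolys m = {p. \<forall>t \<in> Poly_Mapping.keys p. Poly_Mapping.keys t \<subseteq> {1..m}}"

definition mpoly_eval :: "'a::comm_semiring_1 mpoly \<Rightarrow> (nat \<Rightarrow> 'a) \<Rightarrow> 'a" where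
  "mpoly_eval p x =
     (\<Sum>t \<in> Poly_Mapping.keys p. Poly_Mapping.lookup p t *
        (\<Prod>i \<in> Poly_Mapping.keys t. x i ^ Poly_Mapping.lookup t i))"

definition monom_degree :: "(nat \<Rightarrow>\<^sub>0 nat) \<Rightarrow> nat" where
  "monom_degree t = (\<Sum>i \<in> Poly_Mapping.keys t. Poly_Mapping.lookup t i)"

definition mpoly_homogeneous :: "nat \<Rightarrow> 'a::zero mpoly \<Rightarrow> bool" where
  "mpoly_homogeneous n p \<longleftrightarrow> (\<forall>t \<in> Poly_Mapping.keys p. monom_degree t = n)"

definition mpoly_stable :: "nat \<Rightarrow> complex mpoly \<Rightarrow> bool" where
  "mpoly_stable m p \<longleftrightarrow> (\<forall>z. (\<forall>i \<in> {1..m}. Im (z i) > 0) \<longrightarrow> mpoly_eval p z \<noteq> 0)"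

text \<open>Reality of the coefficients is expressed by the type.\<close>

definition mpoly_real_stable :: "nat \<Rightarrow> real mpoly \<Rightarrow> bool" where
  "mpoly_real_stable m p \<longleftrightarrow> mpoly_stable m (Poly_Mapping.map complex_of_real p)"

definition set_coeff :: "'a::zero mpoly \<Rightarrow> nat set \<Rightarrow> 'a" where
  "set_coeff p S = Poly_Mapping.lookup p (\<Sum>i\<in>S. Poly_Mapping.single i 1)"

definition n_subsets :: "nat \<Rightarrow> nat \<Rightarrow> nat set set" where
  "n_subsets m n = {S. S \<subseteq> {1..m} \<and> card S = n}"

text \<open>Only the coordinates \<open>y 1, \<dots>, y m\<close> matter; the remaining values of \<open>y\<close> are arbitrary.\<close>

definition feasible_points :: "nat \<Rightarrow> nat \<Rightarrow> (nat \<Rightarrow> real) set" where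
  "feasible_points m n =
     {y. (\<forall>i \<in> {1..m}. y i > 0) \<and> (\<forall>S \<in> n_subsets m n. (\<Prod>i\<in>S. y i) \<ge> 1)}"

end

theory Submission
  imports Defs
    "HOL-Library.Indicator_Function"
    "HOL-Analysis.Convex"
    "HOL-Computational_Algebra.Fundamental_Theorem_Algebra"
begin

text \<open>
  The polynomial \<open>P(y) = p(y) (y\<^sub>1 + \<dots> + y\<^sub>m)\<^bsup>m-n\<^esup>\<close> is stable and homogeneous of degree \<open>m\<close>, and its
  coefficient at \<open>y\<^sub>1 \<cdots> y\<^sub>m\<close> is \<open>(m-n)!\<close> times the sum of the \<open>c\<^sub>S\<close>. Gurvits' capacity inequality
  bounds this coefficient below by \<open>m!/m\<^sup>m\<close> times the infimum of \<open>P(y) / (y\<^sub>1 \<cdots> y\<^sub>m)\<close> over positive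
  \<open>y\<close>, and scaling together with AM-GM compares that infimum with the one of \<open>p\<close> over the feasible
  points.

  The capacity inequality removes one variable at a time, passing to \<open>\<partial>p/\<partial>y\<^sub>m\<close> at \<open>y\<^sub>m = 0\<close>. If \<open>p\<close> is
  stable and homogeneous, then \<open>s \<mapsto> p(y + s x)\<close> is real-rooted for positive \<open>y\<close> and real \<open>x\<close>, whence
  \<open>\<bar>p(x + \<i> y)\<bar> \<ge> \<bar>p(y)\<bar>\<close>. With nonnegative coefficients, this inequality takes the place of Hurwitz'
  theorem: it shows that the derivative is stable by Gauss--Lucas, since \<open>p\<close> cannot be constant along
  an axis it depends on, and it survives in the limit \<open>y\<^sub>m \<rightarrow> 0\<close>. The loss per variable is that of a
  real-rooted univariate \<open>R\<close> of degree at most \<open>m\<close> with \<open>R(t) \<ge> C t\<close> for \<open>t > 0\<close>: AM-GM on the linear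
  factors of \<open>R\<close> gives \<open>R'(0) \<ge> ((m-1)/m)\<^bsup>m-1\<^esup> C\<close>.
\<close>

section \<open>Real-rooted polynomials\<close>

lemma prod_le_power_mean:
  fixes x :: "'a \<Rightarrow> real"
  assumes "finite A" and "\<And>i. i \<in> A \<Longrightarrow> x i \<ge> 0"
  shows "prod x A \<le> (sum x A / card A) ^ card A"
proof (cases "A = {}")
  case False
  then have card: "card A > 0"
    using assms(1) by (simp add: card_gt_0_iff)
  have nonneg: "prod x A \<ge> 0"
    using assms(2) by (rule prod_nonneg)
  have "root (card A) (prod x A) \<le> sum x A / card A"
    using arith_geom_mean[of A x] assms False card nonneg
    by (simp add: sum_divide_distrib root_powr_inverse)
  then have "root (card A) (prod x A) ^ card A \<le> (sum x A / card A) ^ card A"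
    using nonneg by (intro power_mono) (auto simp: real_root_ge_zero)
  then show ?thesis
    using card nonneg by simp
qed simp

lemma coeff_1_prod_linear:
  fixes a :: "'a \<Rightarrow> 'b::comm_semiring_1"
  shows "coeff (\<Prod>k\<in>A. [:1, a k:]) 1 = (\<Sum>k\<in>A. a k)"
proof (induction A rule: infinite_finite_induct)
  case (insert b A)
  have "coeff (\<Prod>k\<in>A. [:1, a k:]) 0 = 1"
    by (simp add: poly_prod flip: poly_0_coeff_0)
  with insert show ?case
    by (simp add: add.commute)
qed simp_all

lemma complex_poly_factorization:
  fixes g :: "complex poly"
  assumes "poly g 0 \<noteq> 0" and "degree g \<le> d"
  obtains a where "g = smult (poly g 0) (\<Prod>k<d. [:1, a k:])"
    and "\<And>k. a k \<noteq> 0 \<Longrightarrow> poly g (- 1 / a k) = 0"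
proof -
  obtain r where r: "smult (lead_coeff g) (\<Prod>k<degree g. [:- r k, 1:]) = g"
    by (rule complex_poly_decompose')
  define a where "a k = (if k < degree g then - 1 / r k else 0)" for k
  define c where "c = lead_coeff g * (\<Prod>k<degree g. - r k)"
  have root: "poly g (r k) = 0" if "k < degree g" for k
    using that by (subst r[symmetric]) (auto simp: poly_prod intro!: prod_zero)
  then have nonzero: "r k \<noteq> 0" if "k < degree g" for k
    using that assms(1) by metis
  have "(\<Prod>k<degree g. [:- r k, 1:]) = (\<Prod>k<degree g. smult (- r k) [:1, a k:])"
    using nonzero by (intro prod.cong) (auto simp: a_def)
  also have "\<dots> = smult (\<Prod>k<degree g. - r k) (\<Prod>k<degree g. [:1, a k:])"
    by (rule prod_smult)
  also have "(\<Prod>k<degree g. [:1, a k:]) = (\<Prod>k<d. [:1, a k:])"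
    using assms(2) by (intro prod.mono_neutral_left) (auto simp: a_def)
  finally have g: "g = smult c (\<Prod>k<d. [:1, a k:])"
    using r by (simp add: c_def)
  then have "poly g 0 = poly (smult c (\<Prod>k<d. [:1, a k:])) 0"
    by simp
  then have "c = poly g 0"
    by (simp add: poly_prod)
  moreover have "poly g (- 1 / a k) = 0" if "a k \<noteq> 0" for k
    using that root[of k] by (auto simp: a_def split: if_splits)
  ultimately show ?thesis
    using that[of a] g by blast
qed

text \<open>This is the Gauss--Lucas theorem for a half plane, at the single point \<open>0\<close>.\<close>

lemma coeff_1_nonzero_if_roots_in_lower_halfplane:
  fixes g :: "complex poly"
  assumes "degree g > 0" and nonzero: "poly g 0 \<noteq> 0" and roots: "\<And>w. poly g w = 0 \<Longrightarrow> Im w < 0"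
  shows "coeff g 1 \<noteq> 0"
proof -
  obtain a where g: "g = smult (poly g 0) (\<Prod>k<degree g. [:1, a k:])"
    and root: "\<And>k. a k \<noteq> 0 \<Longrightarrow> poly g (- 1 / a k) = 0"
    using complex_poly_factorization[OF nonzero order_refl] by blast
  have lower: "Im (a k) < 0" if "a k \<noteq> 0" for k
  proof -
    have "Im (- 1 / a k) = Im (a k) / (cmod (a k))\<^sup>2"
      by (simp add: Im_divide cmod_power2)
    then show ?thesis
      using roots[OF root[OF that]] that by (simp add: divide_less_0_iff)
  qed
  have nonpos: "Im (a k) \<le> 0" for k
    using lower[of k] by (cases "a k = 0") auto
  have "\<exists>k<degree g. a k \<noteq> 0"
  proof (rule ccontr)
    assume "\<not> ?thesis"
    then have "g = [:poly g 0:]"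
      by (subst g) (simp flip: one_pCons)
    then show False
      using \<open>degree g > 0\<close> by (metis degree_pCons_0 less_irrefl)
  qed
  then obtain k where "k < degree g" "a k \<noteq> 0"
    by blast
  then have "(\<Sum>k<degree g. - Im (a k)) > 0"
    using lower nonpos by (intro sum_pos2[of _ k]) auto
  then have "(\<Sum>k<degree g. a k) \<noteq> 0"
    by (auto simp: sum_negf simp flip: Im_sum)
  moreover have "coeff g 1 = poly g 0 * (\<Sum>k<degree g. a k)"
    by (subst g) (simp only: coeff_smult coeff_1_prod_linear)
  ultimately show ?thesis
    using nonzero by simp
qed

lemma norm_poly_0_le_if_real_rooted:
  fixes g :: "complex poly"
  assumes roots: "\<And>w. poly g w = 0 \<Longrightarrow> w \<in> \<real>" and "Re z = 0"
  shows "cmod (poly g 0) \<le> cmod (poly g z)"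
proof (cases "poly g 0 = 0")
  case False
  obtain a where g: "g = smult (poly g 0) (\<Prod>k<degree g. [:1, a k:])"
    and root: "\<And>k. a k \<noteq> 0 \<Longrightarrow> poly g (- 1 / a k) = 0"
    using complex_poly_factorization[OF False order_refl] by blast
  have "1 \<le> cmod (1 + z * a k)" for k
  proof (cases "a k = 0")
    case False
    have "inverse (- 1 / a k) \<in> \<real>"
      using roots[OF root[OF False]] by (rule Reals_inverse)
    then have "a k \<in> \<real>"
      by simp
    then have "Re (1 + z * a k) = 1"
      using \<open>Re z = 0\<close> by (auto elim!: Reals_cases)
    then show ?thesis
      by (metis complex_Re_le_cmod)
  qed simp
  then have "1 \<le> (\<Prod>k<degree g. cmod (1 + z * a k))"
    by (intro prod_ge_1) auto
  then have "cmod (poly g 0) \<le> cmod (poly g 0) * (\<Prod>k<degree g. cmod (1 + z * a k))"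
    by (simp add: mult_le_cancel_left1)
  also have "\<dots> = cmod (poly g z)"
    by (subst (3) g) (simp add: poly_prod norm_mult prod_norm)
  finally show ?thesis .
qed simp

lemma coeff_power_le_poly:
  fixes R :: "real poly"
  assumes "\<And>k. coeff R k \<ge> 0" and "t \<ge> 0"
  shows "coeff R k * t ^ k \<le> poly R t"
proof (cases "k \<le> degree R")
  case True
  then show ?thesis
    unfolding poly_altdef using assms by (intro member_le_sum) auto
next
  case False
  then show ?thesis
    unfolding poly_altdef using assms by (simp add: coeff_eq_0 sum_nonneg)
qed

lemma poly_map_poly_of_real:
  "poly (map_poly of_real p) (of_real x :: 'a::{real_algebra_1, comm_semiring_1}) = of_real (poly p x)"
  by (induction p) (simp_all add: map_poly_pCons)

lemma real_root_neg_if_coeffs_nonneg: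
  fixes R :: "real poly"
  assumes coeffs: "\<And>k. coeff R k \<ge> 0" and "poly R 0 \<noteq> 0" and "poly R x = 0"
  shows "x < 0"
proof (rule ccontr)
  assume "\<not> x < 0"
  then have "poly R 0 \<le> poly R x"
    using coeff_power_le_poly[OF coeffs, of x 0] by (simp add: poly_0_coeff_0)
  then show False
    using assms coeffs[of 0] by (simp add: poly_0_coeff_0)
qed

lemma neg_inverse_root_nonneg:
  fixes R :: "real poly"
  assumes coeffs: "\<And>k. coeff R k \<ge> 0" and nonzero: "poly R 0 \<noteq> 0"
    and roots: "\<And>w. poly (map_poly complex_of_real R) w = 0 \<Longrightarrow> w \<in> \<real>"
    and "c \<noteq> 0" and root: "poly (map_poly complex_of_real R) (- 1 / c) = 0"
  shows "\<exists>b\<ge>0. c = complex_of_real b"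
proof -
  obtain x where x: "- 1 / c = complex_of_real x"
    using roots[OF root] by (rule Reals_cases)
  then have "poly R x = 0"
    using root poly_map_poly_of_real[of R x, where 'a = complex] by simp
  then have "x < 0"
    by (rule real_root_neg_if_coeffs_nonneg[OF coeffs nonzero])
  moreover have "c = complex_of_real (- 1 / x)"
    using x \<open>c \<noteq> 0\<close> \<open>x < 0\<close> by (auto simp: field_simps)
  ultimately show ?thesis
    by (intro exI[of _ "- 1 / x"]) auto
qed

lemma real_rooted_factorization:
  fixes R :: "real poly"
  assumes coeffs: "\<And>k. coeff R k \<ge> 0" and nonzero: "poly R 0 \<noteq> 0" and deg: "degree R \<le> d"
    and roots: "\<And>w. poly (map_poly complex_of_real R) w = 0 \<Longrightarrow> w \<in> \<real>"
  obtains a where "\<And>k. a k \<ge> 0" and "R = smult (poly R 0) (\<Prod>k<d. [:1, a k:])"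
proof -
  let ?g = "map_poly complex_of_real R"
  have at_0: "poly ?g 0 = complex_of_real (poly R 0)"
    using poly_map_poly_of_real[of R 0] by simp
  obtain a where g: "?g = smult (poly ?g 0) (\<Prod>k<d. [:1, a k:])"
    and root: "\<And>k. a k \<noteq> 0 \<Longrightarrow> poly ?g (- 1 / a k) = 0"
  proof (rule complex_poly_factorization)
    show "poly ?g 0 \<noteq> 0"
      using nonzero at_0 by simp
    show "degree ?g \<le> d"
      using deg by (simp add: degree_map_poly)
  qed blast
  have "\<exists>b\<ge>0. a k = complex_of_real b" for k
    using neg_inverse_root_nonneg[OF coeffs nonzero roots _ root] by (cases "a k = 0") auto
  then obtain b where b: "\<And>k. b k \<ge> 0" "\<And>k. a k = complex_of_real (b k)"
    by metis
  have "poly R t = poly (smult (poly R 0) (\<Prod>k<d. [:1, b k:])) t" for t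
  proof -
    have "complex_of_real (poly R t) = poly ?g (complex_of_real t)"
      by (simp add: poly_map_poly_of_real)
    also have "\<dots> = complex_of_real (poly (smult (poly R 0) (\<Prod>k<d. [:1, b k:])) t)"
      by (subst g) (simp add: poly_prod b at_0)
    finally show ?thesis
      by (simp only: of_real_eq_iff)
  qed
  then show ?thesis
    using that[of b] b(1) poly_eq_poly_eq_iff by blast
qed

lemma real_rooted_le_power:
  fixes R :: "real poly"
  assumes "\<And>k. coeff R k \<ge> 0" and nonzero: "poly R 0 \<noteq> 0" and "degree R \<le> d" and "d > 0"
    and "\<And>w. poly (map_poly complex_of_real R) w = 0 \<Longrightarrow> w \<in> \<real>" and "t \<ge> 0"
  shows "poly R t \<le> poly R 0 * (1 + coeff R 1 / poly R 0 * t / d) ^ d"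
proof -
  obtain a where a: "\<And>k. a k \<ge> 0" and R: "R = smult (poly R 0) (\<Prod>k<d. [:1, a k:])"
    using real_rooted_factorization assms by metis
  have "coeff R 1 = poly R 0 * (\<Sum>k<d. a k)"
    by (subst R) (simp only: coeff_smult coeff_1_prod_linear)
  then have slope: "coeff R 1 / poly R 0 = (\<Sum>k<d. a k)"
    using nonzero by simp
  have "poly R t = poly R 0 * (\<Prod>k<d. 1 + t * a k)"
    by (subst R) (simp add: poly_prod)
  also have "\<dots> \<le> poly R 0 * ((\<Sum>k<d. 1 + t * a k) / d) ^ d"
    using prod_le_power_mean[of "{..<d}" "\<lambda>k. 1 + t * a k"] assms(1)[of 0] a \<open>t \<ge> 0\<close>
    by (intro mult_left_mono) (auto simp: poly_0_coeff_0)
  also have "(\<Sum>k<d. 1 + t * a k) / d = 1 + coeff R 1 / poly R 0 * t / d"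
    unfolding slope using \<open>d > 0\<close>
    by (simp add: sum.distrib sum_distrib_left add_divide_distrib mult.commute)
  finally show ?thesis .
qed

lemma pos_slope_ge_if_linear_le_power:
  fixes a s C :: real
  assumes "a > 0" and "s > 0" and "d > 0"
    and le: "\<And>t. t > 0 \<Longrightarrow> C * t \<le> a * (1 + s / a * t / Suc d) ^ Suc d"
  shows "(d / Suc d) ^ d * C \<le> s"
proof -
  define r where "r = Suc d / d"
  define t where "t = a * r / s"
  have pos: "r > 0" "t > 0"
    using assms by (simp_all add: r_def t_def)
  have "s / a * t = r"
    using assms by (simp add: t_def)
  moreover have "r / Suc d = 1 / d"
    by (simp add: r_def del: of_nat_Suc)
  moreover have "1 + 1 / d = r"
    using \<open>d > 0\<close> by (simp add: r_def field_simps)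
  ultimately have "C * t \<le> a * r ^ Suc d"
    using le[OF \<open>t > 0\<close>] by simp
  then have "C * (a * r) \<le> s * r ^ d * (a * r)"
    using \<open>s > 0\<close> by (simp add: t_def pos_divide_le_eq mult_ac)
  then have "C \<le> s * r ^ d"
    using \<open>a > 0\<close> pos by (subst (asm) mult_le_cancel_right) auto
  then show ?thesis
    using \<open>d > 0\<close> by (simp add: r_def power_divide field_simps del: of_nat_Suc)
qed

lemma slope_ge_if_linear_le_power:
  fixes a s C :: real
  assumes "a > 0" and "s \<ge> 0"
    and le: "\<And>t. t > 0 \<Longrightarrow> C * t \<le> a * (1 + s / a * t / Suc d) ^ Suc d"
  shows "(d / Suc d) ^ d * C \<le> s"
proof (rule field_le_epsilon)
  fix e :: real
  assume "e > 0"
  show "(d / Suc d) ^ d * C \<le> s + e"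
  proof (cases "d = 0")
    case True
    have "C * (a / e) \<le> a * (1 + s / a * (a / e))"
      using le[of "a / e"] \<open>e > 0\<close> \<open>a > 0\<close> True by simp
    then have "C * a \<le> (s + e) * a"
      using \<open>e > 0\<close> \<open>a > 0\<close> by (simp add: field_simps)
    then show ?thesis
      using \<open>a > 0\<close> True by simp
  next
    case False
    show ?thesis
    proof (rule pos_slope_ge_if_linear_le_power)
      fix t :: real
      assume "t > 0"
      then have "a * (1 + s / a * t / Suc d) ^ Suc d \<le> a * (1 + (s + e) / a * t / Suc d) ^ Suc d"
        using assms(1,2) \<open>e > 0\<close>
        by (intro mult_left_mono power_mono add_left_mono divide_right_mono mult_right_mono) auto
      then show "C * t \<le> a * (1 + (s + e) / a * t / Suc d) ^ Suc d"
        using le[OF \<open>t > 0\<close>] by linarith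
    qed (use assms(1,2) \<open>e > 0\<close> False in auto)
  qed
qed

lemma real_rooted_coeff_1_ge:
  fixes R :: "real poly"
  assumes coeffs: "\<And>k. coeff R k \<ge> 0" and "degree R \<le> Suc d"
    and "\<And>w. poly (map_poly complex_of_real R) w = 0 \<Longrightarrow> w \<in> \<real>"
    and "C \<ge> 0" and ge: "\<And>t. t > 0 \<Longrightarrow> C * t \<le> poly R t"
  shows "(d / Suc d) ^ d * C \<le> coeff R 1"
proof (cases "poly R 0 = 0")
  case True
  then obtain Q where Q: "R = pCons 0 Q"
    by (metis poly_0_coeff_0 coeff_pCons_0 pCons_cases)
  have "((\<lambda>t. poly Q t) \<longlongrightarrow> poly Q 0) (at_right 0)"
    by (intro tendsto_intros)
  moreover have "C \<le> poly Q t" if "t > 0" for t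
    using ge[OF that] that by (simp add: Q mult.commute)
  ultimately have "C \<le> poly Q 0"
    by (intro tendsto_lowerbound[of "poly Q" _ "at_right 0"]) (auto simp: eventually_at_filter)
  moreover have "(d / Suc d) ^ d * C \<le> 1 * C"
    using \<open>C \<ge> 0\<close> by (intro mult_right_mono power_le_one) auto
  ultimately show ?thesis
    by (simp add: Q poly_0_coeff_0)
next
  case False
  show ?thesis
  proof (rule slope_ge_if_linear_le_power)
    show "poly R 0 > 0"
      using False coeffs[of 0] by (simp add: poly_0_coeff_0)
    show "coeff R 1 \<ge> 0"
      by (rule coeffs)
    show "C * t \<le> poly R 0 * (1 + coeff R 1 / poly R 0 * t / Suc d) ^ Suc d" if "t > 0" for t
      using real_rooted_le_power[of R "Suc d" t] ge[OF that] that False assms by fastforce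
  qed
qed

section \<open>Evaluation of multivariate polynomials\<close>

definition monom_eval :: "(nat \<Rightarrow>\<^sub>0 nat) \<Rightarrow> (nat \<Rightarrow> 'a::comm_semiring_1) \<Rightarrow> 'a" where
  "monom_eval t x = (\<Prod>i\<in>Poly_Mapping.keys t. x i ^ Poly_Mapping.lookup t i)"

abbreviation monom_of_set :: "nat set \<Rightarrow> nat \<Rightarrow>\<^sub>0 nat" where
  "monom_of_set S \<equiv> (\<Sum>i\<in>S. Poly_Mapping.single i 1)"

abbreviation of_real_mpoly :: "real mpoly \<Rightarrow> complex mpoly" where
  "of_real_mpoly \<equiv> Poly_Mapping.map complex_of_real"

lemma in_mpolysD:
  assumes "p \<in> mpolys m" and "t \<in> Poly_Mapping.keys p" and "i \<in> Poly_Mapping.keys t"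
  shows "i \<in> {1..m}"
  using assms unfolding mpolys_def by blast

lemma monom_eval_superset:
  assumes "finite A" and "Poly_Mapping.keys t \<subseteq> A"
  shows "monom_eval t x = (\<Prod>i\<in>A. x i ^ Poly_Mapping.lookup t i)"
  unfolding monom_eval_def using assms by (intro prod.mono_neutral_left) (auto simp: in_keys_iff)

lemma monom_eval_add: "monom_eval (s + t) x = monom_eval s x * monom_eval t x"
proof -
  let ?A = "Poly_Mapping.keys s \<union> Poly_Mapping.keys t"
  have "monom_eval (s + t) x = (\<Prod>i\<in>?A. x i ^ Poly_Mapping.lookup (s + t) i)"
    using keys_add[of s t] by (intro monom_eval_superset) auto
  also have "\<dots> = monom_eval s x * monom_eval t x"
    by (simp add: monom_eval_superset[of ?A] lookup_add power_add prod.distrib)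
  finally show ?thesis .
qed

lemma monom_eval_single: "monom_eval (Poly_Mapping.single i k) x = x i ^ k"
  by (simp add: monom_eval_def)

lemma monom_eval_cong:
  "(\<And>i. i \<in> Poly_Mapping.keys t \<Longrightarrow> x i = y i) \<Longrightarrow> monom_eval t x = monom_eval t y"
  by (simp add: monom_eval_def)

lemma monom_eval_scale: "monom_eval t (\<lambda>i. u * x i) = u ^ monom_degree t * monom_eval t x"
  by (simp add: monom_eval_def monom_degree_def power_mult_distrib prod.distrib power_sum)

lemma monom_eval_pos:
  fixes x :: "nat \<Rightarrow> 'a :: linordered_semidom"
  shows "(\<And>i. i \<in> Poly_Mapping.keys t \<Longrightarrow> x i > 0) \<Longrightarrow> monom_eval t x > 0"
  by (simp add: monom_eval_def prod_pos)

lemma monom_degree_add: "monom_degree (s + t) = monom_degree s + monom_degree t"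
  unfolding monom_degree_def by (rule setsum_keys_plus_distrib) auto

lemma monom_degree_single: "monom_degree (Poly_Mapping.single i k) = k"
  by (simp add: monom_degree_def)

lemma lookup_monom_of_set:
  "finite S \<Longrightarrow> Poly_Mapping.lookup (monom_of_set S) i = (if i \<in> S then 1 else 0)"
  by (simp add: lookup_sum lookup_single when_def)

lemma mpoly_eval_eq_sum:
  "mpoly_eval p x = (\<Sum>t\<in>Poly_Mapping.keys p. Poly_Mapping.lookup p t * monom_eval t x)"
  by (simp add: mpoly_eval_def monom_eval_def)

lemma mpoly_eval_superset:
  assumes "finite A" and "Poly_Mapping.keys p \<subseteq> A"
  shows "mpoly_eval p x = (\<Sum>t\<in>A. Poly_Mapping.lookup p t * monom_eval t x)"
  unfolding mpoly_eval_eq_sum using assms by (intro sum.mono_neutral_left) (auto simp: in_keys_iff)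

lemma mpoly_eval_scale:
  assumes "mpoly_homogeneous n p"
  shows "mpoly_eval p (\<lambda>i. u * x i) = u ^ n * mpoly_eval p x"
  using assms unfolding mpoly_eval_eq_sum mpoly_homogeneous_def
  by (simp add: monom_eval_scale sum_distrib_left mult_ac)

lemma mpoly_eval_zero [simp]: "mpoly_eval 0 x = 0"
  by (simp add: mpoly_eval_def)

lemma mpoly_eval_add: "mpoly_eval (p + q) x = mpoly_eval p x + mpoly_eval q x"
  unfolding mpoly_eval_eq_sum by (rule setsum_keys_plus_distrib) (simp_all add: distrib_right)

lemma mpoly_eval_single: "mpoly_eval (Poly_Mapping.single t c) x = c * monom_eval t x"
  by (simp add: mpoly_eval_eq_sum)

lemma poly_mapping_eq_sum_single:
  "p = (\<Sum>t\<in>Poly_Mapping.keys p. Poly_Mapping.single t (Poly_Mapping.lookup p t))"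
  by (rule poly_mapping_eqI) (simp add: lookup_sum lookup_single when_def in_keys_iff)

lemma poly_mapping_mult_eq_sum_single:
  fixes p q :: "'a::monoid_add \<Rightarrow>\<^sub>0 'b::semiring_0"
  shows "p * q = (\<Sum>s\<in>Poly_Mapping.keys p. \<Sum>t\<in>Poly_Mapping.keys q.
    Poly_Mapping.single (s + t) (Poly_Mapping.lookup p s * Poly_Mapping.lookup q t))"
  by (subst (1) poly_mapping_eq_sum_single, subst (2) poly_mapping_eq_sum_single)
     (simp add: sum_product mult_single)

lemma poly_mapping_mult_hom:
  fixes F :: "('a::monoid_add \<Rightarrow>\<^sub>0 'b::semiring_0) \<Rightarrow> 'c::semiring_0"
  assumes "F 0 = 0" and add: "\<And>p q. F (p + q) = F p + F q"
    and single: "\<And>s t a b. F (Poly_Mapping.single (s + t) (a * b)) =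
      F (Poly_Mapping.single s a) * F (Poly_Mapping.single t b)"
  shows "F (p * q) = F p * F q"
proof -
  have sum: "F (sum f A) = (\<Sum>a\<in>A. F (f a))" for f :: "'a \<Rightarrow> _" and A
    using assms by (induction A rule: infinite_finite_induct) auto
  have "F (p * q) = (\<Sum>s\<in>Poly_Mapping.keys p. \<Sum>t\<in>Poly_Mapping.keys q.
      F (Poly_Mapping.single s (Poly_Mapping.lookup p s)) *
      F (Poly_Mapping.single t (Poly_Mapping.lookup q t)))"
    by (subst poly_mapping_mult_eq_sum_single) (simp add: sum single)
  also have "\<dots> = F p * F q"
    by (subst (2) poly_mapping_eq_sum_single, subst (4) poly_mapping_eq_sum_single)
       (simp add: sum sum_product)
  finally show ?thesis .
qed

lemma mpoly_eval_mult: "mpoly_eval (p * q) x = mpoly_eval p x * mpoly_eval q x"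
  by (rule poly_mapping_mult_hom)
     (simp_all add: mpoly_eval_add mpoly_eval_single monom_eval_add mult_ac)

lemma mpoly_eval_power: "mpoly_eval (p ^ k) x = mpoly_eval p x ^ k"
proof (induction k)
  case 0
  have "mpoly_eval 1 x = mpoly_eval (Poly_Mapping.single 0 1) x"
    by simp
  also have "\<dots> = 1"
    by (simp only: mpoly_eval_single) (simp add: monom_eval_def)
  finally show ?case
    by simp
qed (simp add: mpoly_eval_mult)

lemma tendsto_mpoly_eval [tendsto_intros]:
  fixes p :: "'a::real_normed_field mpoly"
  assumes "\<And>i. ((\<lambda>a. f a i) \<longlongrightarrow> x i) F"
  shows "((\<lambda>a. mpoly_eval p (f a)) \<longlongrightarrow> mpoly_eval p x) F"
  unfolding mpoly_eval_def by (intro tendsto_intros assms)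

lemma mpoly_eval_pos:
  fixes p :: "real mpoly"
  assumes "p \<in> mpolys m" and "\<And>t. Poly_Mapping.lookup p t \<ge> 0" and "p \<noteq> 0"
    and "\<And>i. i \<in> {1..m} \<Longrightarrow> x i > 0"
  shows "mpoly_eval p x > 0"
  unfolding mpoly_eval_eq_sum
proof (rule sum_pos)
  show "Poly_Mapping.keys p \<noteq> {}"
    using \<open>p \<noteq> 0\<close> by simp
  show "Poly_Mapping.lookup p t * monom_eval t x > 0" if "t \<in> Poly_Mapping.keys p" for t
  proof (intro mult_pos_pos monom_eval_pos)
    show "Poly_Mapping.lookup p t > 0"
      using that assms(2)[of t] by (simp add: in_keys_iff less_le)
    show "x i > 0" if "i \<in> Poly_Mapping.keys t" for i
      using in_mpolysD[OF assms(1) \<open>t \<in> Poly_Mapping.keys p\<close> that] by (rule assms(4))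
  qed
qed simp

lemma lookup_of_real_mpoly:
  "Poly_Mapping.lookup (of_real_mpoly p) t = complex_of_real (Poly_Mapping.lookup p t)"
  by (simp add: map.rep_eq when_def)

lemma keys_of_real_mpoly: "Poly_Mapping.keys (of_real_mpoly p) = Poly_Mapping.keys p"
  by (auto simp: in_keys_iff lookup_of_real_mpoly)

lemma of_real_mpoly_mult: "of_real_mpoly (p * q) = of_real_mpoly p * of_real_mpoly q"
  by (rule poly_mapping_mult_hom)
     (auto intro!: poly_mapping_eqI simp: lookup_of_real_mpoly lookup_add mult_single)

lemma mpoly_eval_of_real_mpoly:
  "mpoly_eval (of_real_mpoly p) (\<lambda>i. complex_of_real (x i)) = complex_of_real (mpoly_eval p x)"
  by (simp add: mpoly_eval_def keys_of_real_mpoly lookup_of_real_mpoly)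

lemma mpolys_mult:
  assumes "p \<in> mpolys m" and "q \<in> mpolys m"
  shows "p * q \<in> mpolys m"
  unfolding mpolys_def
proof (intro CollectI ballI)
  fix t assume "t \<in> Poly_Mapping.keys (p * q)"
  then obtain u v where "t = u + v" "u \<in> Poly_Mapping.keys p" "v \<in> Poly_Mapping.keys q"
    using keys_mult by blast
  then show "Poly_Mapping.keys t \<subseteq> {1..m}"
    using assms keys_add[of u v] unfolding mpolys_def by blast
qed

lemma mpoly_homogeneous_mult:
  assumes "mpoly_homogeneous a p" and "mpoly_homogeneous b q"
  shows "mpoly_homogeneous (a + b) (p * q)"
  using assms keys_mult[of p q] unfolding mpoly_homogeneous_def
  by (fastforce simp: monom_degree_add)

lemma lookup_mult_nonneg:
  fixes p q :: "'a::monoid_add \<Rightarrow>\<^sub>0 'b::linordered_semidom"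
  assumes "\<And>s. Poly_Mapping.lookup p s \<ge> 0" and "\<And>s. Poly_Mapping.lookup q s \<ge> 0"
  shows "Poly_Mapping.lookup (p * q) t \<ge> 0"
  using assms by (subst poly_mapping_mult_eq_sum_single)
    (simp add: lookup_sum lookup_single when_def sum_nonneg)

section \<open>Restriction to a line\<close>

definition line_poly :: "'a::comm_semiring_1 mpoly \<Rightarrow> (nat \<Rightarrow> 'a) \<Rightarrow> (nat \<Rightarrow> 'a) \<Rightarrow> 'a poly" where
  "line_poly p y x = (\<Sum>t\<in>Poly_Mapping.keys p.
     smult (Poly_Mapping.lookup p t) (monom_eval t (\<lambda>i. [:y i, x i:])))"

lemma poly_line_poly: "poly (line_poly p y x) s = mpoly_eval p (\<lambda>i. y i + s * x i)"
  by (simp add: line_poly_def mpoly_eval_eq_sum monom_eval_def poly_sum poly_prod poly_power)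

lemma degree_line_poly_le:
  assumes "mpoly_homogeneous n p"
  shows "degree (line_poly p y x) \<le> n"
  unfolding line_poly_def
proof (rule degree_sum_le)
  fix t assume t: "t \<in> Poly_Mapping.keys p"
  have "degree (monom_eval t (\<lambda>i. [:y i, x i:])) \<le>
      (\<Sum>i\<in>Poly_Mapping.keys t. degree ([:y i, x i:] ^ Poly_Mapping.lookup t i))"
    unfolding monom_eval_def
    using degree_prod_sum_le[of "Poly_Mapping.keys t" "\<lambda>i. [:y i, x i:] ^ Poly_Mapping.lookup t i"]
    by (simp add: o_def)
  also have "\<dots> \<le> monom_degree t"
    unfolding monom_degree_def
  proof (rule sum_mono)
    show "degree ([:y i, x i:] ^ k) \<le> k" for i k
      using degree_power_le[of "[:y i, x i:]" k] by (auto split: if_splits intro: order_trans)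
  qed
  finally show "degree (smult (Poly_Mapping.lookup p t) (monom_eval t (\<lambda>i. [:y i, x i:]))) \<le> n"
    using t assms degree_smult_le order_trans unfolding mpoly_homogeneous_def by metis
qed simp

lemma coeff_prod_nonneg:
  fixes f :: "'a \<Rightarrow> 'b::linordered_semidom poly"
  assumes "\<And>i k. i \<in> A \<Longrightarrow> coeff (f i) k \<ge> 0"
  shows "coeff (prod f A) k \<ge> 0"
  using assms
  by (induction A arbitrary: k rule: infinite_finite_induct) (auto simp: coeff_mult intro!: sum_nonneg)

lemma coeff_power_nonneg:
  fixes p :: "'b::linordered_semidom poly"
  assumes "\<And>k. coeff p k \<ge> 0"
  shows "coeff (p ^ n) k \<ge> 0"
  using coeff_prod_nonneg[of "{..<n}" "\<lambda>_. p"] assms by simp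

lemma coeff_line_poly_nonneg:
  fixes p :: "real mpoly"
  assumes "p \<in> mpolys m" and "\<And>t. Poly_Mapping.lookup p t \<ge> 0"
    and "\<And>i. i \<in> {1..m} \<Longrightarrow> y i \<ge> 0" and "\<And>i. i \<in> {1..m} \<Longrightarrow> x i \<ge> 0"
  shows "coeff (line_poly p y x) k \<ge> 0"
proof -
  have "coeff (monom_eval t (\<lambda>i. [:y i, x i:])) k \<ge> 0" if "t \<in> Poly_Mapping.keys p" for t
    unfolding monom_eval_def
    using assms(3,4) in_mpolysD[OF assms(1) that]
    by (intro coeff_prod_nonneg coeff_power_nonneg) (simp add: coeff_pCons split: nat.split)
  then show ?thesis
    using assms by (simp add: line_poly_def coeff_sum sum_nonneg)
qed

lemma map_poly_of_real_line_poly: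
  "map_poly complex_of_real (line_poly p y x) =
    line_poly (of_real_mpoly p) (\<lambda>i. complex_of_real (y i)) (\<lambda>i. complex_of_real (x i))"
  (is "?f = ?g")
proof (rule ccontr)
  assume "?f \<noteq> ?g"
  then have "finite {w. poly (?f - ?g) w = 0}"
    by (intro poly_roots_finite) simp
  moreover have "poly (?f - ?g) (complex_of_real s) = 0" for s
    using mpoly_eval_of_real_mpoly[of p "\<lambda>i. y i + s * x i"]
    by (simp add: poly_map_poly_of_real poly_line_poly)
  then have "range complex_of_real \<subseteq> {w. poly (?f - ?g) w = 0}"
    by blast
  ultimately show False
    using finite_subset finite_imageD[of complex_of_real UNIV] infinite_UNIV_char_0
    by (metis inj_of_real)
qed

section \<open>Partial derivatives\<close>

definition mpoly_pderiv :: "nat \<Rightarrow> 'a::comm_semiring_1 mpoly \<Rightarrow> 'a mpoly" where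
  "mpoly_pderiv i p = Poly_Mapping.mapp (\<lambda>t c. of_nat (Suc (Poly_Mapping.lookup t i)) * c)
     (Poly_Mapping.map_key (\<lambda>t. t + Poly_Mapping.single i 1) p)"

definition mpoly_set_zero :: "nat \<Rightarrow> 'a::comm_semiring_1 mpoly \<Rightarrow> 'a mpoly" where
  "mpoly_set_zero i p = Poly_Mapping.mapp (\<lambda>t c. if Poly_Mapping.lookup t i = 0 then c else 0) p"

lemma lookup_mpoly_pderiv:
  "Poly_Mapping.lookup (mpoly_pderiv i p) t =
    of_nat (Suc (Poly_Mapping.lookup t i)) * Poly_Mapping.lookup p (t + Poly_Mapping.single i 1)"
  by (simp add: mpoly_pderiv_def lookup_mapp map_key.rep_eq when_def keys_map_key in_keys_iff)

lemma lookup_mpoly_set_zero: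
  "Poly_Mapping.lookup (mpoly_set_zero i p) t =
    (if Poly_Mapping.lookup t i = 0 then Poly_Mapping.lookup p t else 0)"
  by (simp add: mpoly_set_zero_def lookup_mapp when_def in_keys_iff)

lemma mpoly_set_zero_0 [simp]: "mpoly_set_zero i 0 = 0"
  by (rule poly_mapping_eqI) (simp add: lookup_mpoly_set_zero)

lemma keys_mpoly_pderiv:
  "t \<in> Poly_Mapping.keys (mpoly_pderiv i p) \<Longrightarrow> t + Poly_Mapping.single i 1 \<in> Poly_Mapping.keys p"
  by (auto simp: in_keys_iff lookup_mpoly_pderiv)

lemma keys_mpoly_set_zero:
  "t \<in> Poly_Mapping.keys (mpoly_set_zero i p) \<Longrightarrow>
    t \<in> Poly_Mapping.keys p \<and> Poly_Mapping.lookup t i = 0"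
  by (auto simp: in_keys_iff lookup_mpoly_set_zero split: if_splits)

lemma of_real_mpoly_pderiv: "of_real_mpoly (mpoly_pderiv i p) = mpoly_pderiv i (of_real_mpoly p)"
  by (rule poly_mapping_eqI) (simp add: lookup_of_real_mpoly lookup_mpoly_pderiv)

lemma of_real_mpoly_set_zero:
  "of_real_mpoly (mpoly_set_zero i p) = mpoly_set_zero i (of_real_mpoly p)"
  by (rule poly_mapping_eqI) (simp add: lookup_of_real_mpoly lookup_mpoly_set_zero)

lemma mpoly_pderiv_in_mpolys:
  assumes "p \<in> mpolys m"
  shows "mpoly_pderiv i p \<in> mpolys m"
  unfolding mpolys_def
proof (intro CollectI ballI)
  fix t assume "t \<in> Poly_Mapping.keys (mpoly_pderiv i p)"
  then have "Poly_Mapping.keys (t + Poly_Mapping.single i 1) \<subseteq> {1..m}"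
    using assms keys_mpoly_pderiv by (auto simp: mpolys_def)
  then show "Poly_Mapping.keys t \<subseteq> {1..m}"
    by (auto simp: in_keys_iff lookup_add subset_iff)
qed

lemma mpoly_homogeneous_pderiv:
  assumes "mpoly_homogeneous (Suc n) p"
  shows "mpoly_homogeneous n (mpoly_pderiv i p)"
  unfolding mpoly_homogeneous_def
proof
  fix t assume "t \<in> Poly_Mapping.keys (mpoly_pderiv i p)"
  then have "monom_degree (t + Poly_Mapping.single i 1) = Suc n"
    using assms keys_mpoly_pderiv by (auto simp: mpoly_homogeneous_def)
  then show "monom_degree t = n"
    by (simp add: monom_degree_add monom_degree_single)
qed

lemma mpoly_set_zero_in_mpolys:
  assumes "p \<in> mpolys (Suc m)"
  shows "mpoly_set_zero (Suc m) p \<in> mpolys m"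
  unfolding mpolys_def
proof (intro CollectI ballI)
  fix t assume "t \<in> Poly_Mapping.keys (mpoly_set_zero (Suc m) p)"
  then have "Poly_Mapping.keys t \<subseteq> {1..Suc m}" "Suc m \<notin> Poly_Mapping.keys t"
    using assms keys_mpoly_set_zero[of t "Suc m" p] by (auto simp: mpolys_def in_keys_iff)
  then show "Poly_Mapping.keys t \<subseteq> {1..m}"
    by (auto simp: subset_iff le_Suc_eq)
qed

lemma mpoly_homogeneous_set_zero:
  "mpoly_homogeneous n p \<Longrightarrow> mpoly_homogeneous n (mpoly_set_zero i p)"
  using keys_mpoly_set_zero unfolding mpoly_homogeneous_def by blast

lemma mpoly_eval_set_zero: "mpoly_eval (mpoly_set_zero i p) x = mpoly_eval p (x(i := 0))"
proof -
  have "Poly_Mapping.lookup (mpoly_set_zero i p) t * monom_eval t x =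
      Poly_Mapping.lookup p t * monom_eval t (x(i := 0))" for t
  proof (cases "Poly_Mapping.lookup t i = 0")
    case True
    then have "monom_eval t x = monom_eval t (x(i := 0))"
      by (intro monom_eval_cong) (auto simp: in_keys_iff)
    then show ?thesis
      using True by (simp add: lookup_mpoly_set_zero)
  next
    case False
    then have "monom_eval t (x(i := 0)) = 0"
      unfolding monom_eval_def
      by (intro prod_zero) (auto simp: in_keys_iff zero_power intro!: bexI[of _ i])
    then show ?thesis
      using False by (simp add: lookup_mpoly_set_zero)
  qed
  moreover have "mpoly_eval (mpoly_set_zero i p) x =
      (\<Sum>t\<in>Poly_Mapping.keys p. Poly_Mapping.lookup (mpoly_set_zero i p) t * monom_eval t x)"
    using keys_mpoly_set_zero by (intro mpoly_eval_superset) auto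
  ultimately show ?thesis
    by (simp add: mpoly_eval_eq_sum)
qed

lemma monom_eval_const_poly: "monom_eval t (\<lambda>l. [:y l:]) = [:monom_eval t y:]"
  by (simp add: monom_eval_def poly_const_pow prod_to_poly)

lemma coeff_1_monom_eval_axis:
  fixes y :: "nat \<Rightarrow> 'a::comm_semiring_1"
  shows "coeff (monom_eval t (\<lambda>l. [:y l, indicator {i} l:])) 1 =
    of_nat (Poly_Mapping.lookup t i) * monom_eval (t - Poly_Mapping.single i 1) y"
proof (cases "Poly_Mapping.lookup t i")
  case 0
  then have "monom_eval t (\<lambda>l. [:y l, indicator {i} l:]) = monom_eval t (\<lambda>l. [:y l:])"
    by (intro monom_eval_cong) (auto simp: in_keys_iff indicator_def)
  then show ?thesis
    using 0 by (simp add: monom_eval_const_poly)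
next
  case (Suc k)
  define s where "s = t - Poly_Mapping.single i (Suc k)"
  have s: "Poly_Mapping.lookup s i = 0"
    using Suc by (simp add: s_def lookup_minus)
  have t: "t = s + Poly_Mapping.single i (Suc k)"
    "t - Poly_Mapping.single i 1 = s + Poly_Mapping.single i k"
    using Suc
    by (auto intro!: poly_mapping_eqI simp: s_def lookup_add lookup_minus lookup_single when_def)
  have "monom_eval s (\<lambda>l. [:y l, indicator {i} l:]) = monom_eval s (\<lambda>l. [:y l:])"
    using s by (intro monom_eval_cong) (auto simp: in_keys_iff indicator_def)
  then have "monom_eval t (\<lambda>l. [:y l, indicator {i} l:]) =
      smult (monom_eval s y) ([:y i, 1:] ^ Suc k)"
    by (simp add: t(1) monom_eval_add monom_eval_single monom_eval_const_poly del: power_Suc)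
  moreover have "coeff ([:y i, 1:] ^ Suc k) 1 = of_nat (Suc k) * y i ^ k"
    using coeff_linear_poly_power[of 1 "Suc k" "y i" 1] by simp
  ultimately show ?thesis
    unfolding t(2) Suc by (simp add: monom_eval_add monom_eval_single mult_ac del: power_Suc)
qed

lemma mpoly_eval_pderiv:
  "mpoly_eval (mpoly_pderiv i p) y = (\<Sum>t\<in>Poly_Mapping.keys p. Poly_Mapping.lookup p t *
    (of_nat (Poly_Mapping.lookup t i) * monom_eval (t - Poly_Mapping.single i 1) y))"
proof -
  let ?e = "Poly_Mapping.single i 1 :: nat \<Rightarrow>\<^sub>0 nat"
  have inj: "inj (\<lambda>t. t + ?e)"
    by (rule injI) simp
  define K where "K = (\<lambda>t. t + ?e) -` Poly_Mapping.keys p"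
  have "finite K"
    unfolding K_def using finite_keys inj by (rule finite_vimageI)
  have "mpoly_eval (mpoly_pderiv i p) y =
      (\<Sum>t\<in>K. Poly_Mapping.lookup (mpoly_pderiv i p) t * monom_eval t y)"
    using \<open>finite K\<close> keys_mpoly_pderiv by (intro mpoly_eval_superset) (auto simp: K_def)
  also have "\<dots> = (\<Sum>t\<in>(\<lambda>t. t + ?e) ` K.
      Poly_Mapping.lookup p t * (of_nat (Poly_Mapping.lookup t i) * monom_eval (t - ?e) y))"
    by (subst sum.reindex) (auto simp: inj_on_def lookup_mpoly_pderiv lookup_add mult_ac)
  also have "\<dots> = (\<Sum>t\<in>Poly_Mapping.keys p.
      Poly_Mapping.lookup p t * (of_nat (Poly_Mapping.lookup t i) * monom_eval (t - ?e) y))"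
  proof (intro sum.mono_neutral_left ballI)
    fix t assume t: "t \<in> Poly_Mapping.keys p - (\<lambda>t. t + ?e) ` K"
    have "Poly_Mapping.lookup t i = 0"
    proof (rule ccontr)
      assume "Poly_Mapping.lookup t i \<noteq> 0"
      then have "t = (t - ?e) + ?e"
        by (intro poly_mapping_eqI) (auto simp: lookup_add lookup_minus lookup_single when_def)
      moreover from this have "t - ?e \<in> K"
        using t by (simp add: K_def)
      ultimately show False
        using t by blast
    qed
    then show "Poly_Mapping.lookup p t * (of_nat (Poly_Mapping.lookup t i) * monom_eval (t - ?e) y) = 0"
      by simp
  qed (auto simp: K_def)
  finally show ?thesis .
qed

lemma coeff_1_line_poly_axis:
  "coeff (line_poly p y (indicator {i})) 1 = mpoly_eval (mpoly_pderiv i p) y"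
  by (simp add: line_poly_def coeff_sum coeff_1_monom_eval_axis mpoly_eval_pderiv del: One_nat_def)

section \<open>Stable forms\<close>

lemma mpoly_homogeneous_of_real_mpoly:
  "mpoly_homogeneous n p \<Longrightarrow> mpoly_homogeneous n (of_real_mpoly p)"
  by (simp add: mpoly_homogeneous_def keys_of_real_mpoly)

lemma stable_mpoly_eval_line_nonzero:
  assumes homogeneous: "mpoly_homogeneous n p" and stable: "mpoly_stable m p"
    and pos: "\<And>i. i \<in> {1..m} \<Longrightarrow> y i > 0" and "Im s \<noteq> 0"
  shows "mpoly_eval p (\<lambda>i. complex_of_real (y i) + s * complex_of_real (x i)) \<noteq> 0"
proof
  assume zero: "mpoly_eval p (\<lambda>i. complex_of_real (y i) + s * complex_of_real (x i)) = 0"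
  \<comment> \<open>Since \<open>u s\<close> is real, multiplication by \<open>u\<close> moves the zero into the upper half space.\<close>
  define u where "u = complex_of_real (- sgn (Im s)) / s"
  have "s \<noteq> 0"
    using \<open>Im s \<noteq> 0\<close> by auto
  then have rotate: "u * (complex_of_real a + s * complex_of_real b) =
      u * complex_of_real a - complex_of_real (sgn (Im s) * b)" for a b
    by (simp add: u_def field_simps)
  have "Im u = \<bar>Im s\<bar> / (cmod s)\<^sup>2"
    by (simp add: u_def Im_divide cmod_power2 abs_sgn)
  then have "Im u > 0"
    using \<open>Im s \<noteq> 0\<close> \<open>s \<noteq> 0\<close> by simp
  then have "mpoly_eval p (\<lambda>i. u * (complex_of_real (y i) + s * complex_of_real (x i))) \<noteq> 0"
    using stable pos unfolding mpoly_stable_def rotate by simp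
  then show False
    using zero by (simp add: mpoly_eval_scale[OF homogeneous])
qed

lemma norm_mpoly_eval_Im_le:
  assumes homogeneous: "mpoly_homogeneous n p" and stable: "mpoly_stable m p"
    and pos: "\<And>i. i \<in> {1..m} \<Longrightarrow> Im (z i) > 0"
  shows "cmod (mpoly_eval p (\<lambda>i. complex_of_real (Im (z i)))) \<le> cmod (mpoly_eval p z)"
proof -
  let ?g = "line_poly p (\<lambda>i. complex_of_real (Im (z i))) (\<lambda>i. complex_of_real (Re (z i)))"
  have "w \<in> \<real>" if "poly ?g w = 0" for w
    using that stable_mpoly_eval_line_nonzero[OF homogeneous stable pos, of "\<lambda>i. i" w "\<lambda>i. Re (z i)"]
    by (auto simp: poly_line_poly complex_is_Real_iff)
  then have "cmod (poly ?g 0) \<le> cmod (poly ?g (- \<i>))"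
    by (rule norm_poly_0_le_if_real_rooted) simp_all
  also have "\<dots> = cmod (mpoly_eval p
      (\<lambda>i. \<i> * (complex_of_real (Im (z i)) + - \<i> * complex_of_real (Re (z i)))))"
    unfolding mpoly_eval_scale[OF homogeneous] by (simp add: poly_line_poly norm_mult norm_power)
  also have "(\<lambda>i. \<i> * (complex_of_real (Im (z i)) + - \<i> * complex_of_real (Re (z i)))) = z"
    by (simp add: fun_eq_iff complex_eq_iff)
  finally show ?thesis
    by (simp add: poly_line_poly)
qed

locale stable_form =
  fixes m n :: nat and p :: "real mpoly"
  assumes variables: "p \<in> mpolys m"
    and homogeneous: "mpoly_homogeneous n p"
    and stable: "mpoly_real_stable m p"
    and nonneg: "\<And>t. Poly_Mapping.lookup p t \<ge> 0"
begin

lemma eval_Im_le_norm_eval: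
  assumes "\<And>i. i \<in> {1..m} \<Longrightarrow> Im (z i) > 0"
  shows "mpoly_eval p (\<lambda>i. Im (z i)) \<le> cmod (mpoly_eval (of_real_mpoly p) z)"
proof -
  have "mpoly_eval p (\<lambda>i. Im (z i)) \<le>
      cmod (mpoly_eval (of_real_mpoly p) (\<lambda>i. complex_of_real (Im (z i))))"
    by (simp add: mpoly_eval_of_real_mpoly)
  also have "\<dots> \<le> cmod (mpoly_eval (of_real_mpoly p) z)"
    using stable assms unfolding mpoly_real_stable_def
    by (intro norm_mpoly_eval_Im_le[OF mpoly_homogeneous_of_real_mpoly[OF homogeneous]]) auto
  finally show ?thesis .
qed

lemma axis_line_poly_real_rooted:
  assumes pos: "\<And>l. l \<in> {1..m} - {i} \<Longrightarrow> y l > 0"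
    and root: "poly (map_poly complex_of_real (line_poly p (y(i := 0)) (indicator {i}))) w = 0"
  shows "w \<in> \<real>"
proof (rule ccontr)
  assume "w \<notin> \<real>"
  then have "mpoly_eval (of_real_mpoly p) (\<lambda>l. complex_of_real ((y(i := 1)) l) +
      (w - 1) * complex_of_real (indicator {i} l)) \<noteq> 0"
    using stable pos unfolding mpoly_real_stable_def
    by (intro stable_mpoly_eval_line_nonzero[OF mpoly_homogeneous_of_real_mpoly[OF homogeneous]])
       (auto simp: complex_is_Real_iff)
  also have "(\<lambda>l. complex_of_real ((y(i := 1)) l) + (w - 1) * complex_of_real (indicator {i} l)) =
      (\<lambda>l. complex_of_real ((y(i := 0)) l) + w * complex_of_real (indicator {i} l))"
    by (auto simp: indicator_def)
  finally show False
    using root by (simp add: map_poly_of_real_line_poly poly_line_poly)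
qed

lemma degree_axis_line_poly_pos:
  assumes nonzero: "mpoly_pderiv i p \<noteq> 0"
    and upper: "\<And>l. l \<in> {1..m} \<Longrightarrow> Im (z l) > 0"
  shows "degree (line_poly (of_real_mpoly p) z (indicator {i})) > 0"
proof (rule ccontr)
  let ?g = "line_poly (of_real_mpoly p) z (indicator {i})"
  let ?y = "\<lambda>l. Im (z l)"
  let ?D = "mpoly_eval (mpoly_pderiv i p) ?y"
  define T where "T = (cmod (poly ?g 0) + 1) / ?D"
  have "?D > 0"
    using nonzero nonneg upper
    by (intro mpoly_eval_pos[OF mpoly_pderiv_in_mpolys[OF variables]])
       (auto simp: lookup_mpoly_pderiv)
  then have "T > 0"
    by (simp add: T_def add_nonneg_pos)
  assume "\<not> degree ?g > 0"
  then have const: "poly ?g w = poly ?g 0" for w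
    by (auto elim: degree_eq_zeroE)
  have "?D * T ^ 1 \<le> poly (line_poly p ?y (indicator {i})) T"
    unfolding coeff_1_line_poly_axis[symmetric] using \<open>T > 0\<close> upper
    by (intro coeff_power_le_poly coeff_line_poly_nonneg[OF variables nonneg]) (auto simp: less_imp_le)
  also have "\<dots> = mpoly_eval p (\<lambda>l. Im (z l + \<i> * of_real T * indicator {i} l))"
    unfolding poly_line_poly
    by (intro arg_cong[where f = "mpoly_eval p"] ext) (simp add: indicator_def)
  also have "\<dots> \<le> cmod (poly ?g (\<i> * of_real T))"
    unfolding poly_line_poly using upper \<open>T > 0\<close>
    by (intro eval_Im_le_norm_eval) (auto simp: indicator_def intro: add_pos_pos)
  also have "\<dots> = ?D * T - 1"
    unfolding const[of "\<i> * of_real T"] using \<open>?D > 0\<close> by (simp add: T_def)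
  finally show False
    by simp
qed

lemma eval_Im_le_norm_eval_boundary:
  assumes upper: "\<And>l. l \<in> {1..m} - {i} \<Longrightarrow> Im (z l) > 0"
  shows "mpoly_eval p ((\<lambda>l. Im (z l))(i := 0)) \<le> cmod (mpoly_eval (of_real_mpoly p) (z(i := 0)))"
proof -
  define w where "w e = z(i := \<i> * complex_of_real e)" for e
  have w: "((\<lambda>e. w e l) \<longlongrightarrow> (z(i := 0)) l) (at_right 0)" for l
    by (cases "l = i") (auto simp: w_def intro!: tendsto_eq_intros)
  have "mpoly_eval p (\<lambda>l. Im (w e l)) \<le> cmod (mpoly_eval (of_real_mpoly p) (w e))"
    if "e > 0" for e
    using that upper by (intro eval_Im_le_norm_eval) (auto simp: w_def)
  then have "\<forall>\<^sub>F e in at_right 0.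
      mpoly_eval p (\<lambda>l. Im (w e l)) \<le> cmod (mpoly_eval (of_real_mpoly p) (w e))"
    by (auto simp: eventually_at_filter)
  then have "mpoly_eval p (\<lambda>l. Im ((z(i := 0)) l)) \<le>
      cmod (mpoly_eval (of_real_mpoly p) (z(i := 0)))"
    by (rule tendsto_le[OF trivial_limit_at_right_real, rotated 2]) (intro tendsto_intros w)+
  moreover have "(\<lambda>l. Im ((z(i := 0)) l)) = (\<lambda>l. Im (z l))(i := 0)"
    by auto
  ultimately show ?thesis
    by simp
qed

end

text \<open>Along the \<open>i\<close>-th axis through a point of the upper half space, \<open>p\<close> is a nonconstant univariate
  polynomial all of whose roots lie in the lower half plane, so that Gauss--Lucas applies.\<close>

lemma stable_form_pderiv:
  assumes "stable_form m (Suc n) p" and nonzero: "mpoly_pderiv i p \<noteq> 0"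
  shows "stable_form m n (mpoly_pderiv i p)"
proof
  interpret stable_form m "Suc n" p
    by fact
  show "mpoly_pderiv i p \<in> mpolys m"
    using variables by (rule mpoly_pderiv_in_mpolys)
  show "mpoly_homogeneous n (mpoly_pderiv i p)"
    using homogeneous by (rule mpoly_homogeneous_pderiv)
  show "Poly_Mapping.lookup (mpoly_pderiv i p) t \<ge> 0" for t
    using nonneg by (simp add: lookup_mpoly_pderiv)
  show "mpoly_real_stable m (mpoly_pderiv i p)"
    unfolding mpoly_real_stable_def mpoly_stable_def
  proof (intro allI impI)
    fix z :: "nat \<Rightarrow> complex"
    assume upper: "\<forall>l\<in>{1..m}. Im (z l) > 0"
    let ?g = "line_poly (of_real_mpoly p) z (indicator {i})"
    have no_root: "poly ?g w \<noteq> 0" if "Im w \<ge> 0" for w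
    proof -
      have "\<forall>l\<in>{1..m}. Im (z l + w * indicator {i} l) > 0"
        using upper that by (auto simp: indicator_def intro: add_pos_nonneg)
      then show ?thesis
        using stable unfolding poly_line_poly mpoly_real_stable_def mpoly_stable_def
        by (elim allE) (rule mp)
    qed
    have "coeff ?g 1 \<noteq> 0"
    proof (rule coeff_1_nonzero_if_roots_in_lower_halfplane)
      show "degree ?g > 0"
        using degree_axis_line_poly_pos nonzero upper by blast
      show "poly ?g 0 \<noteq> 0"
        by (rule no_root) simp
      show "Im w < 0" if "poly ?g w = 0" for w
        using no_root that not_less by blast
    qed
    then show "mpoly_eval (of_real_mpoly (mpoly_pderiv i p)) z \<noteq> 0"
      unfolding coeff_1_line_poly_axis of_real_mpoly_pderiv .
  qed
qed

lemma stable_form_set_zero: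
  assumes "stable_form (Suc m) n p" and nonzero: "mpoly_set_zero (Suc m) p \<noteq> 0"
  shows "stable_form m n (mpoly_set_zero (Suc m) p)"
proof
  interpret stable_form "Suc m" n p
    by fact
  let ?q = "mpoly_set_zero (Suc m) p"
  show variables': "?q \<in> mpolys m"
    using variables by (rule mpoly_set_zero_in_mpolys)
  show "mpoly_homogeneous n ?q"
    using homogeneous by (rule mpoly_homogeneous_set_zero)
  show nonneg': "Poly_Mapping.lookup ?q t \<ge> 0" for t
    using nonneg by (simp add: lookup_mpoly_set_zero)
  show "mpoly_real_stable m ?q"
    unfolding mpoly_real_stable_def mpoly_stable_def
  proof (intro allI impI)
    fix z :: "nat \<Rightarrow> complex"
    assume upper: "\<forall>i\<in>{1..m}. Im (z i) > 0"
    have "mpoly_eval ?q (\<lambda>i. Im (z i)) \<le> cmod (mpoly_eval (of_real_mpoly ?q) z)"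
      unfolding of_real_mpoly_set_zero mpoly_eval_set_zero
      using upper by (intro eval_Im_le_norm_eval_boundary) (auto simp: le_Suc_eq)
    moreover have "mpoly_eval ?q (\<lambda>i. Im (z i)) > 0"
      using upper by (intro mpoly_eval_pos[OF variables' nonneg' nonzero]) auto
    ultimately show "mpoly_eval (of_real_mpoly ?q) z \<noteq> 0"
      by auto
  qed
qed

lemma stable_form_mult:
  assumes "stable_form m a p" and "stable_form m b q"
  shows "stable_form m (a + b) (p * q)"
proof
  interpret p: stable_form m a p by fact
  interpret q: stable_form m b q by fact
  show "p * q \<in> mpolys m"
    using p.variables q.variables by (rule mpolys_mult)
  show "mpoly_homogeneous (a + b) (p * q)"
    using p.homogeneous q.homogeneous by (rule mpoly_homogeneous_mult)
  show "mpoly_real_stable m (p * q)"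
    using p.stable q.stable
    by (simp add: mpoly_real_stable_def mpoly_stable_def of_real_mpoly_mult mpoly_eval_mult)
  show "Poly_Mapping.lookup (p * q) t \<ge> 0" for t
    using p.nonneg q.nonneg by (rule lookup_mult_nonneg)
qed

section \<open>Gurvits' capacity inequality\<close>

definition capacity :: "nat \<Rightarrow> real mpoly \<Rightarrow> real" where
  "capacity m p = (INF y\<in>{y. \<forall>i\<in>{1..m}. y i > 0}. mpoly_eval p y / (\<Prod>i=1..m. y i))"

lemma le_capacity:
  assumes "\<And>y. (\<And>i. i \<in> {1..m} \<Longrightarrow> y i > 0) \<Longrightarrow> C * (\<Prod>i=1..m. y i) \<le> mpoly_eval p y"
  shows "C \<le> capacity m p"
  unfolding capacity_def
proof (rule cINF_greatest)
  show "{y :: nat \<Rightarrow> real. \<forall>i\<in>{1..m}. y i > 0} \<noteq> {}"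
    by (auto intro: exI[of _ "\<lambda>_. 1"])
  show "C \<le> mpoly_eval p y / (\<Prod>i=1..m. y i)" if "y \<in> {y. \<forall>i\<in>{1..m}. y i > 0}" for y
  proof -
    have "(\<Prod>i=1..m. y i) > 0"
      using that by (intro prod_pos) auto
    then show ?thesis
      using that assms[of y] by (simp add: pos_le_divide_eq)
  qed
qed

context
  fixes m :: nat and p :: "real mpoly"
  assumes variables: "p \<in> mpolys m" and nonneg: "\<And>t. Poly_Mapping.lookup p t \<ge> 0"
begin

lemma mpoly_eval_nonneg: "(\<And>i. i \<in> {1..m} \<Longrightarrow> y i > 0) \<Longrightarrow> mpoly_eval p y \<ge> 0"
  using mpoly_eval_pos[OF variables nonneg, of y] by (cases "p = 0") (auto simp: less_imp_le)

lemma capacity_nonneg: "capacity m p \<ge> 0"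
proof (rule le_capacity)
  show "0 * (\<Prod>i=1..m. y i) \<le> mpoly_eval p y" if "\<And>i. i \<in> {1..m} \<Longrightarrow> y i > 0" for y
    using mpoly_eval_nonneg[OF that] by simp
qed

lemma capacity_mult_prod_le:
  assumes "\<And>i. i \<in> {1..m} \<Longrightarrow> y i > 0"
  shows "capacity m p * (\<Prod>i=1..m. y i) \<le> mpoly_eval p y"
proof -
  have "capacity m p \<le> mpoly_eval p y / (\<Prod>i=1..m. y i)"
    unfolding capacity_def using assms
    by (intro cINF_lower bdd_belowI[of _ 0])
       (auto intro!: divide_nonneg_nonneg mpoly_eval_nonneg prod_nonneg simp: less_imp_le)
  moreover have "(\<Prod>i=1..m. y i) > 0"
    using assms by (intro prod_pos) auto
  ultimately show ?thesis
    by (simp add: pos_le_divide_eq)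
qed

end

lemma capacity_0_le_set_coeff:
  assumes "p \<in> mpolys 0" and "\<And>t. Poly_Mapping.lookup p t \<ge> 0"
  shows "capacity 0 p \<le> set_coeff p {}"
proof -
  have "capacity 0 p \<le> mpoly_eval p (\<lambda>_. 1)"
    using capacity_mult_prod_le[OF assms, of "\<lambda>_. 1"] by simp
  also have "\<dots> = Poly_Mapping.lookup p 0"
    using assms(1) by (subst mpoly_eval_superset[of "{0}"]) (auto simp: mpolys_def monom_eval_def)
  finally show ?thesis
    by (simp add: set_coeff_def)
qed

lemma capacity_pderiv_ge:
  assumes "stable_form (Suc m) (Suc m) p"
  shows "(m / Suc m) ^ m * capacity (Suc m) p \<le>
    capacity m (mpoly_set_zero (Suc m) (mpoly_pderiv (Suc m) p))"
proof (rule le_capacity)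
  interpret stable_form "Suc m" "Suc m" p
    by fact
  fix y :: "nat \<Rightarrow> real"
  assume y: "\<And>i. i \<in> {1..m} \<Longrightarrow> y i > 0"
  let ?R = "line_poly p (y(Suc m := 0)) (indicator {Suc m})"
  let ?C = "capacity (Suc m) p * (\<Prod>i=1..m. y i)"
  have "(m / Suc m) ^ m * ?C \<le> coeff ?R 1"
  proof (rule real_rooted_coeff_1_ge)
    show "coeff ?R k \<ge> 0" for k
      using y
      by (intro coeff_line_poly_nonneg[OF variables nonneg]) (auto simp: less_imp_le le_Suc_eq)
    show "degree ?R \<le> Suc m"
      using homogeneous by (rule degree_line_poly_le)
    show "w \<in> \<real>" if "poly (map_poly complex_of_real ?R) w = 0" for w
      by (rule axis_line_poly_real_rooted[OF _ that]) (auto simp: y le_Suc_eq)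
    show "?C \<ge> 0"
      using y
      by (intro mult_nonneg_nonneg capacity_nonneg[OF variables nonneg] prod_nonneg)
         (auto simp: less_imp_le)
    show "?C * t \<le> poly ?R t" if "t > 0" for t
    proof -
      have "(\<Prod>i=1..m. (y(Suc m := t)) i) = (\<Prod>i=1..m. y i)"
        by (rule prod.cong) auto
      then have "(\<Prod>i=1..Suc m. (y(Suc m := t)) i) = (\<Prod>i=1..m. y i) * t"
        by simp
      moreover have "capacity (Suc m) p * (\<Prod>i=1..Suc m. (y(Suc m := t)) i) \<le>
          mpoly_eval p (y(Suc m := t))"
        using y that by (intro capacity_mult_prod_le[OF variables nonneg]) (auto simp: le_Suc_eq)
      moreover have "(\<lambda>i. (y(Suc m := 0)) i + t * indicator {Suc m} i) = y(Suc m := t)"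
        by (auto simp: indicator_def)
      ultimately show ?thesis
        by (simp add: poly_line_poly mult.assoc)
    qed
  qed
  then show "(m / Suc m) ^ m * capacity (Suc m) p * (\<Prod>i=1..m. y i) \<le>
      mpoly_eval (mpoly_set_zero (Suc m) (mpoly_pderiv (Suc m) p)) y"
    by (simp add: coeff_1_line_poly_axis mpoly_eval_set_zero mult.assoc del: One_nat_def)
qed

lemma set_coeff_set_zero_pderiv:
  assumes "finite S" and "i \<notin> S"
  shows "set_coeff (mpoly_set_zero i (mpoly_pderiv i p)) S = set_coeff p (insert i S)"
  using assms
  by (simp add: set_coeff_def lookup_mpoly_set_zero lookup_mpoly_pderiv lookup_monom_of_set
      add.commute del: One_nat_def)

lemma fact_over_power_Suc:
  "fact (Suc m) / real (Suc m) ^ Suc m = fact m / real m ^ m * (m / Suc m) ^ m"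
proof -
  have "fact (Suc m) / real (Suc m) ^ Suc m = fact m / real (Suc m) ^ m"
    by (simp del: of_nat_Suc)
  then show ?thesis
    by (cases "m = 0") (simp_all add: power_divide)
qed

theorem capacity_le_set_coeff:
  assumes "stable_form m m p"
  shows "fact m / real m ^ m * capacity m p \<le> set_coeff p {1..m}"
  using assms
proof (induction m arbitrary: p)
  case 0
  then interpret stable_form 0 0 p .
  show ?case
    using capacity_0_le_set_coeff[OF variables nonneg] by simp
next
  case (Suc m)
  interpret stable_form "Suc m" "Suc m" p
    by fact
  let ?q = "mpoly_set_zero (Suc m) (mpoly_pderiv (Suc m) p)"
  have IH: "fact m / real m ^ m * capacity m ?q \<le> set_coeff ?q {1..m}"
  proof (cases "?q = 0")
    case True
    have "capacity m 0 \<le> 0"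
      using capacity_mult_prod_le[of 0 m "\<lambda>_. 1"] by (simp add: mpolys_def)
    then have "fact m / real m ^ m * capacity m 0 \<le> 0"
      by (intro mult_nonneg_nonpos) auto
    then show ?thesis
      unfolding True by (simp add: set_coeff_def)
  next
    case False
    then have "mpoly_pderiv (Suc m) p \<noteq> 0"
      by (metis mpoly_set_zero_0)
    then show ?thesis
      using False Suc.prems by (intro Suc.IH stable_form_set_zero stable_form_pderiv) auto
  qed
  have "fact m / real m ^ m * ((m / Suc m) ^ m * capacity (Suc m) p) \<le>
      fact m / real m ^ m * capacity m ?q"
    using Suc.prems by (intro mult_left_mono capacity_pderiv_ge) auto
  also note IH
  also have "set_coeff ?q {1..m} = set_coeff p {1..Suc m}"
    by (simp add: set_coeff_set_zero_pderiv atLeastAtMostSuc_conv)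
  finally show ?case
    unfolding fact_over_power_Suc by (simp only: mult.assoc)
qed

section \<open>Multilinear coefficients\<close>

definition mpoly_sum_vars :: "nat \<Rightarrow> 'a::comm_semiring_1 mpoly" where
  "mpoly_sum_vars m = (\<Sum>i=1..m. Poly_Mapping.single (Poly_Mapping.single i 1) 1)"

lemma lookup_mult_single:
  fixes p :: "'a::monoid_add \<Rightarrow>\<^sub>0 'b::semiring_1"
  shows "Poly_Mapping.lookup (p * Poly_Mapping.single s 1) t =
    (\<Sum>u\<in>Poly_Mapping.keys p. Poly_Mapping.lookup p u when t = u + s)"
  by (subst poly_mapping_mult_eq_sum_single) (simp add: lookup_sum lookup_single when_def eq_commute)

lemma set_coeff_mult_var:
  fixes p :: "'a::comm_semiring_1 mpoly"
  assumes "finite S"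
  shows "set_coeff (p * Poly_Mapping.single (Poly_Mapping.single i 1) 1) S =
    (if i \<in> S then set_coeff p (S - {i}) else 0)"
proof (cases "i \<in> S")
  case True
  have "monom_of_set S = u + Poly_Mapping.single i 1 \<longleftrightarrow> u = monom_of_set (S - {i})" for u
    unfolding sum.remove[OF assms True] by (subst add.commute) auto
  then show ?thesis
    using True by (simp add: set_coeff_def lookup_mult_single when_def in_keys_iff)
next
  case False
  have "monom_of_set S \<noteq> u + Poly_Mapping.single i 1" for u
  proof
    assume "monom_of_set S = u + Poly_Mapping.single i 1"
    then have "Poly_Mapping.lookup (monom_of_set S) i \<noteq> 0"
      by (simp add: lookup_add)
    then show False
      using assms False by (simp only: lookup_monom_of_set if_False)
  qed
  then show ?thesis
    using False by (simp add: set_coeff_def lookup_mult_single)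
qed

lemma set_coeff_mult_sum_vars:
  assumes "S \<subseteq> {1..m}"
  shows "set_coeff (p * mpoly_sum_vars m) S = (\<Sum>i\<in>S. set_coeff p (S - {i}))"
proof -
  have "finite S"
    using assms finite_subset by blast
  have "set_coeff (p * mpoly_sum_vars m) S =
      (\<Sum>i=1..m. set_coeff (p * Poly_Mapping.single (Poly_Mapping.single i 1) 1) S)"
    by (simp add: mpoly_sum_vars_def sum_distrib_left set_coeff_def lookup_sum)
  also have "\<dots> = (\<Sum>i\<in>S. set_coeff p (S - {i}))"
    using assms \<open>finite S\<close>
    by (intro sum.mono_neutral_cong_right) (auto simp: set_coeff_mult_var simp del: One_nat_def)
  finally show ?thesis .
qed

lemma sum_subsets_remove:
  fixes f :: "'a set \<Rightarrow> 'b::comm_semiring_1"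
  assumes "finite S"
  shows "(\<Sum>i\<in>S. \<Sum>T | T \<subseteq> S - {i} \<and> card T + k = card (S - {i}). f T) =
    of_nat (Suc k) * (\<Sum>T | T \<subseteq> S \<and> card T + Suc k = card S. f T)"
proof -
  have "{T. T \<subseteq> S - {i} \<and> card T + k = card (S - {i})} =
      {T \<in> {T. T \<subseteq> S \<and> card T + Suc k = card S}. i \<notin> T}" if "i \<in> S" for i
  proof -
    have "card S = Suc (card (S - {i}))"
      using assms that by (rule card.remove)
    then show ?thesis
      by auto
  qed
  then have "(\<Sum>i\<in>S. \<Sum>T | T \<subseteq> S - {i} \<and> card T + k = card (S - {i}). f T) =
      (\<Sum>i\<in>S. \<Sum>T\<in>{T \<in> {T. T \<subseteq> S \<and> card T + Suc k = card S}. i \<notin> T}. f T)"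
    by (intro sum.cong refl) simp_all
  also have "\<dots> = (\<Sum>T | T \<subseteq> S \<and> card T + Suc k = card S. \<Sum>i | i \<in> S \<and> i \<notin> T. f T)"
    using assms by (intro sum.swap_restrict) auto
  also have "\<dots> = (\<Sum>T | T \<subseteq> S \<and> card T + Suc k = card S. of_nat (Suc k) * f T)"
  proof (intro sum.cong refl)
    fix T assume T: "T \<in> {T. T \<subseteq> S \<and> card T + Suc k = card S}"
    have "{i. i \<in> S \<and> i \<notin> T} = S - T"
      by blast
    moreover have "card (S - T) = Suc k"
      using T assms finite_subset[of T S] by (auto simp: card_Diff_subset)
    ultimately show "(\<Sum>i | i \<in> S \<and> i \<notin> T. f T) = of_nat (Suc k) * f T"
      by simp
  qed
  finally show ?thesis
    by (simp add: sum_distrib_left)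
qed

lemma set_coeff_mult_sum_vars_power:
  fixes p :: "'a::{comm_semiring_1, semiring_char_0} mpoly"
  assumes "S \<subseteq> {1..m}"
  shows "set_coeff (p * mpoly_sum_vars m ^ k) S =
    fact k * (\<Sum>T | T \<subseteq> S \<and> card T + k = card S. set_coeff p T)"
  using assms
proof (induction k arbitrary: S)
  case 0
  then have "finite S"
    using finite_subset by blast
  then have "{T. T \<subseteq> S \<and> card T + 0 = card S} = {S}"
    by (auto dest: card_subset_eq)
  then show ?case
    by simp
next
  case (Suc k)
  have "set_coeff (p * mpoly_sum_vars m ^ Suc k) S =
      set_coeff (p * mpoly_sum_vars m ^ k * mpoly_sum_vars m) S"
    by (simp add: mult_ac)
  also have "\<dots> = (\<Sum>i\<in>S. set_coeff (p * mpoly_sum_vars m ^ k) (S - {i}))"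
    using Suc.prems by (rule set_coeff_mult_sum_vars)
  also have "\<dots> =
      (\<Sum>i\<in>S. fact k * (\<Sum>T | T \<subseteq> S - {i} \<and> card T + k = card (S - {i}). set_coeff p T))"
    using Suc.prems by (intro sum.cong Suc.IH) auto
  also have "\<dots> = fact k * (of_nat (Suc k) * (\<Sum>T | T \<subseteq> S \<and> card T + Suc k = card S. set_coeff p T))"
    using finite_subset[OF Suc.prems]
    by (simp only: sum_distrib_left[symmetric] sum_subsets_remove finite_atLeastAtMost)
  finally show ?case
    by (simp add: algebra_simps)
qed

lemma set_coeff_mult_sum_vars_power_n_subsets:
  fixes p :: "'a::{comm_semiring_1, semiring_char_0} mpoly"
  assumes "n \<le> m"
  shows "set_coeff (p * mpoly_sum_vars m ^ (m - n)) {1..m} =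
    fact (m - n) * (\<Sum>S\<in>n_subsets m n. set_coeff p S)"
proof -
  have "{T. T \<subseteq> {1..m} \<and> card T + (m - n) = card {1..m}} = n_subsets m n"
    using assms by (auto simp: n_subsets_def)
  then show ?thesis
    by (simp only: set_coeff_mult_sum_vars_power[OF order_refl])
qed

lemma mpoly_eval_sum_vars: "mpoly_eval (mpoly_sum_vars m) x = (\<Sum>i=1..m. x i)"
proof -
  have "mpoly_eval (sum f A) x = (\<Sum>i\<in>A. mpoly_eval (f i) x)" for f :: "nat \<Rightarrow> 'a mpoly" and A
    by (induction A rule: infinite_finite_induct) (simp_all add: mpoly_eval_add)
  then show ?thesis
    by (simp add: mpoly_sum_vars_def mpoly_eval_single monom_eval_single)
qed

lemma of_real_mpoly_sum_vars: "of_real_mpoly (mpoly_sum_vars m) = mpoly_sum_vars m"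
  by (rule poly_mapping_eqI)
     (simp add: lookup_of_real_mpoly mpoly_sum_vars_def lookup_sum lookup_single when_def
       if_distrib cong: if_cong)

lemma keys_mpoly_sum_vars:
  fixes t :: "nat \<Rightarrow>\<^sub>0 nat"
  assumes "t \<in> Poly_Mapping.keys (mpoly_sum_vars m :: 'a::comm_semiring_1 mpoly)"
  obtains i where "i \<in> {1..m}" and "t = Poly_Mapping.single i 1"
  using assms keys_sum[of "\<lambda>i. Poly_Mapping.single (Poly_Mapping.single i 1) (1::'a)" "{1..m}"]
  unfolding mpoly_sum_vars_def by fastforce

lemma stable_form_sum_vars:
  assumes "m > 0"
  shows "stable_form m 1 (mpoly_sum_vars m)"
proof
  show "mpoly_sum_vars m \<in> mpolys m" "mpoly_homogeneous 1 (mpoly_sum_vars m :: real mpoly)"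
    by (auto simp: mpolys_def mpoly_homogeneous_def monom_degree_single elim!: keys_mpoly_sum_vars)
  show "mpoly_real_stable m (mpoly_sum_vars m)"
    unfolding mpoly_real_stable_def mpoly_stable_def of_real_mpoly_sum_vars mpoly_eval_sum_vars
  proof (intro allI impI)
    fix z :: "nat \<Rightarrow> complex"
    assume "\<forall>i\<in>{1..m}. Im (z i) > 0"
    then have "Im (\<Sum>i=1..m. z i) > 0"
      unfolding Im_sum using assms by (intro sum_pos) auto
    then show "(\<Sum>i=1..m. z i) \<noteq> 0"
      by (metis less_irrefl zero_complex.sel(2))
  qed
  show "Poly_Mapping.lookup (mpoly_sum_vars m :: real mpoly) t \<ge> 0" for t
    by (simp add: mpoly_sum_vars_def lookup_sum lookup_single when_def sum_nonneg)
qed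

lemma stable_form_mult_sum_vars_power:
  assumes "stable_form m n p" and "m > 0 \<or> k = 0"
  shows "stable_form m (n + k) (p * mpoly_sum_vars m ^ k)"
  using assms(2)
proof (induction k)
  case 0
  then show ?case
    using assms(1) by simp
next
  case (Suc k)
  then have "stable_form m (n + k + 1) (p * mpoly_sum_vars m ^ k * mpoly_sum_vars m)"
    by (intro stable_form_mult[OF _ stable_form_sum_vars]) auto
  then show ?case
    by (simp add: mult_ac)
qed

section \<open>Comparison of the constants\<close>

lemma incseq_fact_exp_over_power: "incseq (\<lambda>m. fact m * exp (real m) / real m ^ m)"
proof (rule incseq_SucI)
  fix m
  show "fact m * exp (real m) / real m ^ m \<le>
      fact (Suc m) * exp (real (Suc m)) / real (Suc m) ^ Suc m"
  proof (cases "m = 0")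
    case False
    have "(1 + 1 / real m) ^ m \<le> exp 1"
      using False by (intro exp_ge_one_plus_x_over_n_power_n) auto
    also have "1 + 1 / real m = real (Suc m) / real m"
      using False by (simp add: field_simps)
    finally have "1 / real m ^ m \<le> exp 1 / real (Suc m) ^ m"
      using False by (simp add: power_divide field_simps del: of_nat_Suc)
    then have "fact m * exp (real m) * (1 / real m ^ m) \<le>
        fact m * exp (real m) * (exp 1 / real (Suc m) ^ m)"
      by (intro mult_left_mono) auto
    also have "\<dots> = fact (Suc m) * exp (real (Suc m)) / real (Suc m) ^ Suc m"
      by (simp add: exp_of_nat_mult[symmetric] del: of_nat_Suc) (simp add: exp_add)
    finally show ?thesis
      by simp
  qed simp
qed

lemma exp_minus_le_fact_power_ratio:
  assumes "n \<le> m"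
  shows "exp (- real n) \<le> (fact m * real (m - n) ^ (m - n)) / (real m ^ m * fact (m - n))"
proof -
  define k where "k = m - n"
  have "real k ^ k > 0"
    by (cases "k = 0") auto
  have "fact k * exp (real k) / real k ^ k \<le> fact m * exp (real m) / real m ^ m"
    using incseq_fact_exp_over_power by (rule incseqD) (simp add: k_def)
  also have "exp (real m) = exp (real k) * exp (real n)"
    using assms by (simp add: k_def flip: exp_add)
  finally have "exp (real k) * (fact k / real k ^ k) \<le>
      exp (real k) * (fact m * exp (real n) / real m ^ m)"
    by (simp add: mult_ac)
  then have "fact k / real k ^ k \<le> fact m * exp (real n) / real m ^ m"
    by (simp only: mult_le_cancel_left_pos exp_gt_zero)
  then have "exp (- real n) * (real k ^ k / fact k) * (fact k / real k ^ k)
      \<le> exp (- real n) * (real k ^ k / fact k) * (fact m * exp (real n) / real m ^ m)"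
    using \<open>real k ^ k > 0\<close> by (intro mult_left_mono) auto
  also have "\<dots> = (exp (- real n) * exp (real n)) * ((fact m * real k ^ k) / (real m ^ m * fact k))"
    by (simp add: mult_ac)
  finally show ?thesis
    using \<open>real k ^ k > 0\<close> by (simp add: k_def exp_minus)
qed

section \<open>The infimum over the feasible points\<close>

text \<open>Rescale \<open>y\<close> so that the smallest of the products \<open>y\<^sup>S\<close> becomes \<open>1\<close>.\<close>

lemma feasible_bound_mult_minimal_prod_le:
  assumes homogeneous: "mpoly_homogeneous n p" and S: "S \<in> n_subsets m n"
    and le: "\<And>y. y \<in> feasible_points m n \<Longrightarrow> q \<le> mpoly_eval p y"
    and pos: "\<And>i. i \<in> {1..m} \<Longrightarrow> y i > 0"
    and minimal: "\<And>T. T \<in> n_subsets m n \<Longrightarrow> prod y S \<le> prod y T"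
  shows "q * prod y S \<le> mpoly_eval p y"
proof -
  have "prod y S > 0"
    using S pos by (intro prod_pos) (auto simp: n_subsets_def)
  obtain u where u: "u > 0" "u ^ n = 1 / prod y S"
  proof (cases "n = 0")
    case True
    then have "prod y S = 1"
      using S finite_subset[of S "{1..m}"] by (auto simp: n_subsets_def)
    then show ?thesis
      using that[of 1] by simp
  next
    case False
    then show ?thesis
      using that[of "root n (1 / prod y S)"] \<open>prod y S > 0\<close> by simp
  qed
  have "(\<Prod>i\<in>T. u * y i) \<ge> 1" if "T \<in> n_subsets m n" for T
    using minimal[OF that] that \<open>prod y S > 0\<close> u by (simp add: prod.distrib n_subsets_def)
  then have "(\<lambda>i. u * y i) \<in> feasible_points m n"
    using u pos by (auto simp: feasible_points_def)
  then have "q \<le> u ^ n * mpoly_eval p y"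
    using le by (simp flip: mpoly_eval_scale[OF homogeneous])
  then show ?thesis
    using u \<open>prod y S > 0\<close> by (simp add: pos_le_divide_eq)
qed

lemma ex_subset_feasible_bound:
  assumes "n \<le> m" and "mpoly_homogeneous n p"
    and "\<And>y. y \<in> feasible_points m n \<Longrightarrow> q \<le> mpoly_eval p y"
    and "\<And>i. i \<in> {1..m} \<Longrightarrow> y i > 0"
  shows "\<exists>S\<in>n_subsets m n. q * prod y S \<le> mpoly_eval p y"
proof -
  have "finite (n_subsets m n)"
    by (rule finite_subset[of _ "Pow {1..m}"]) (auto simp: n_subsets_def)
  moreover have "{1..n} \<in> n_subsets m n"
    using \<open>n \<le> m\<close> by (auto simp: n_subsets_def)
  ultimately obtain S where "S \<in> n_subsets m n"
    and "\<And>T. T \<in> n_subsets m n \<Longrightarrow> prod y S \<le> prod y T"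
    using arg_min_if_finite[of "n_subsets m n" "prod y"] by (metis empty_iff not_less)
  then show ?thesis
    using feasible_bound_mult_minimal_prod_le[of n p S m q y] assms by blast
qed

lemma power_card_mult_prod_le_power_sum:
  fixes y :: "'a \<Rightarrow> real"
  assumes "finite A" and "T \<subseteq> A" and "\<And>i. i \<in> A \<Longrightarrow> y i \<ge> 0"
  shows "real (card T) ^ card T * prod y T \<le> sum y A ^ card T"
proof -
  have "real (card T) ^ card T * prod y T \<le> real (card T) ^ card T * (sum y T / card T) ^ card T"
    using assms finite_subset by (intro mult_left_mono prod_le_power_mean) auto
  also have "\<dots> \<le> sum y T ^ card T"
    by (cases "card T = 0") (simp_all add: power_divide)
  also have "\<dots> \<le> sum y A ^ card T"
    using assms by (intro power_mono sum_mono2 sum_nonneg) auto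
  finally show ?thesis .
qed

lemma capacity_mult_sum_vars_power_ge:
  assumes "n \<le> m" and "mpoly_homogeneous n p" and "q \<ge> 0"
    and "\<And>y. y \<in> feasible_points m n \<Longrightarrow> q \<le> mpoly_eval p y"
  shows "q * real (m - n) ^ (m - n) \<le> capacity m (p * mpoly_sum_vars m ^ (m - n))"
proof (rule le_capacity)
  fix y :: "nat \<Rightarrow> real"
  assume pos: "\<And>i. i \<in> {1..m} \<Longrightarrow> y i > 0"
  obtain S where S: "S \<subseteq> {1..m}" "card S = n" and le: "q * prod y S \<le> mpoly_eval p y"
    using ex_subset_feasible_bound[of n m p q y] assms pos by (auto simp: n_subsets_def)
  let ?T = "{1..m} - S"
  have card: "card ?T = m - n"
    using S finite_subset[OF S(1)] by (simp add: card_Diff_subset)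
  have "q * real (m - n) ^ (m - n) * (\<Prod>i=1..m. y i) =
      (q * prod y S) * (real (m - n) ^ (m - n) * prod y ?T)"
    using prod.subset_diff[OF S(1), of y] by (simp add: mult_ac)
  also have "\<dots> \<le> mpoly_eval p y * (\<Sum>i=1..m. y i) ^ (m - n)"
  proof (rule mult_mono[OF le])
    show "real (m - n) ^ (m - n) * prod y ?T \<le> (\<Sum>i=1..m. y i) ^ (m - n)"
      using power_card_mult_prod_le_power_sum[of "{1..m}" ?T y] pos
      unfolding card by (simp add: less_imp_le)
    have "0 \<le> q * prod y S"
      using \<open>q \<ge> 0\<close> S pos by (intro mult_nonneg_nonneg prod_nonneg) (auto simp: less_imp_le)
    then show "0 \<le> mpoly_eval p y"
      using le by linarith
    show "0 \<le> real (m - n) ^ (m - n) * prod y ?T"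
      using pos by (intro mult_nonneg_nonneg prod_nonneg) (auto simp: less_imp_le)
  qed
  also have "\<dots> = mpoly_eval (p * mpoly_sum_vars m ^ (m - n)) y"
    by (simp add: mpoly_eval_mult mpoly_eval_power mpoly_eval_sum_vars)
  finally show "q * real (m - n) ^ (m - n) * (\<Prod>i=1..m. y i) \<le>
      mpoly_eval (p * mpoly_sum_vars m ^ (m - n)) y" .
qed

context stable_form
begin

lemma mpoly_eval_feasible_points_nonneg: "y \<in> feasible_points m n \<Longrightarrow> mpoly_eval p y \<ge> 0"
  by (rule mpoly_eval_nonneg[OF variables nonneg]) (simp add: feasible_points_def)

lemma INF_feasible_points_nonneg: "(INF y\<in>feasible_points m n. mpoly_eval p y) \<ge> 0"
proof (rule cINF_greatest)
  have "(\<lambda>_. 1) \<in> feasible_points m n"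
    by (simp add: feasible_points_def)
  then show "feasible_points m n \<noteq> {}"
    by blast
qed (rule mpoly_eval_feasible_points_nonneg)

lemma INF_feasible_points_le:
  "y \<in> feasible_points m n \<Longrightarrow> (INF y\<in>feasible_points m n. mpoly_eval p y) \<le> mpoly_eval p y"
  using mpoly_eval_feasible_points_nonneg by (intro cINF_lower bdd_belowI[of _ 0]) auto

end

theorem theorem1p2:
  fixes m n :: nat and p :: "real mpoly"
  assumes "n \<le> m"
    and "p \<in> mpolys m"
    and "mpoly_homogeneous n p"
    and "mpoly_real_stable m p"
    and "\<And>t. Poly_Mapping.lookup p t \<ge> 0"
    and "(\<Sum>S \<in> n_subsets m n. set_coeff p S) > 0"
  shows "(\<Sum>S \<in> n_subsets m n. set_coeff p S)
           \<ge> (fact m * real (m - n) ^ (m - n)) / (real m ^ m * fact (m - n))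
               * (INF y \<in> feasible_points m n. mpoly_eval p y)
       \<and> (fact m * real (m - n) ^ (m - n)) / (real m ^ m * fact (m - n))
               * (INF y \<in> feasible_points m n. mpoly_eval p y)
           \<ge> exp (- real n) * (INF y \<in> feasible_points m n. mpoly_eval p y)"
proof -
  let ?k = "m - n" and ?q = "INF y \<in> feasible_points m n. mpoly_eval p y"
  let ?P = "p * mpoly_sum_vars m ^ ?k" and ?c = "\<Sum>S\<in>n_subsets m n. set_coeff p S"
  interpret stable_form m n p
    using assms by unfold_locales
  have "fact m / real m ^ m * (?q * real ?k ^ ?k) \<le> fact m / real m ^ m * capacity m ?P"
    using assms(1) homogeneous INF_feasible_points_nonneg INF_feasible_points_le
    by (intro mult_left_mono capacity_mult_sum_vars_power_ge) auto
  also have "\<dots> \<le> set_coeff ?P {1..m}"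
    using stable_form_mult_sum_vars_power[OF stable_form_axioms, of ?k] assms(1)
    by (intro capacity_le_set_coeff) (cases "m = 0"; auto)
  also have "\<dots> = fact ?k * ?c"
    using assms(1) by (rule set_coeff_mult_sum_vars_power_n_subsets)
  finally have "fact m / real m ^ m * (?q * real ?k ^ ?k) / fact ?k \<le> ?c"
    by (simp only: pos_divide_le_eq fact_gt_zero mult.commute)
  then have "(fact m * real ?k ^ ?k) / (real m ^ m * fact ?k) * ?q \<le> ?c"
    by (simp add: mult_ac)
  moreover have "exp (- real n) * ?q \<le> (fact m * real ?k ^ ?k) / (real m ^ m * fact ?k) * ?q"
    using assms(1) by (intro mult_right_mono exp_minus_le_fact_power_ratio INF_feasible_points_nonneg)
  ultimately show ?thesis
    by blast
qed

end
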